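(* Let $\beta>1$ be the real number with $\beta^4=\beta+1$ (so $\beta\approx1.2207$). Then $T_{-\beta}^{10}(1)=T_{-\beta}^5(1)$, and the sequence $(T_\beta^n(1))_{n\ge0}$ is aperiodic (i.e. not eventually periodic).
   Context: For real $\beta>1$, $T_{-\beta}:(0,1]\to(0,1]$, $x\mapsto -\beta x+\lfloor \beta x\rfloor+1$, and $T_\beta:[0,1]\to[0,1)$, $x\mapsto\beta x-\lfloor\beta x\rfloor$ (in particular $T_\beta(1)=\beta-\lfloor\beta\rfloor$). *)

theory Defs
  imports Complex_Main
begin

text \<open>
  The transformations live on the intervals $(0,1]$ and $[0,1]$, respectively. Here they are
  given by the same formulas on all reals; for \<open>\<beta> > 1\<close> each formula maps its interval into
  itself, so iterating from \<open>1\<close> never leaves the intended domain.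
\<close>

definition neg_beta_map :: "real \<Rightarrow> real \<Rightarrow> real" where
  "neg_beta_map \<beta> x = - \<beta> * x + of_int \<lfloor>\<beta> * x\<rfloor> + 1"

definition beta_map :: "real \<Rightarrow> real \<Rightarrow> real" where
  "beta_map \<beta> x = \<beta> * x - of_int \<lfloor>\<beta> * x\<rfloor>"

definition eventually_periodic :: "(nat \<Rightarrow> 'a) \<Rightarrow> bool" where
  "eventually_periodic a \<longleftrightarrow> (\<exists>N p. p > 0 \<and> (\<forall>n\<ge>N. a (n + p) = a n))"

end

theory Submission
  imports Defs
begin

text \<open>
  The first claim is a finite computation in \<open>\<int>[\<beta>]\<close>.

  For aperiodicity, replace \<open>\<beta>\<close> by a non-real conjugate \<open>\<gamma>\<close>, keeping the digits of the orbit of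
  \<open>1\<close>. As \<open>x ^ 4 - x - 1\<close> is irreducible, an eventually periodic orbit would have an eventually
  periodic conjugate orbit, so some term \<open>z\<close> of the latter would have maximal modulus. But
  \<open>\<bar>\<gamma>\<bar> > 1\<close>, so the modulus grows at a digit \<open>0\<close>, while a digit \<open>1\<close> is followed by at least seven
  zeros, which take \<open>z\<close> to \<open>\<gamma> ^ 7 * (\<gamma> * z - 1)\<close>. The latter has larger modulus than \<open>z\<close> as soon
  as \<open>\<bar>z\<bar> \<ge> \<bar>\<gamma> ^ 7 * (\<gamma> - 1)\<bar>\<close>, which is the modulus of the eighth term.
\<close>

text \<open>Subtracting \<open>p\<close> repeatedly brings every index below \<open>N + p\<close>.
  Finiteness of the range is what lets the moduli of a periodic conjugate orbit attain a
  maximum.\<close>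

lemma eventually_periodic_finite_range:
  assumes "eventually_periodic a"
  shows "finite (range a)"
proof -
  obtain N p where p: "p > 0" and per: "\<And>n. n \<ge> N \<Longrightarrow> a (n + p) = a n"
    using assms unfolding eventually_periodic_def by blast
  have "a n \<in> a ` {..<N + p}" for n
  proof (induction n rule: less_induct)
    case (less n)
    show ?case
    proof (cases "n < N + p")
      case False
      then have "a n = a (n - p)" using per[of "n - p"] by simp
      then show ?thesis using less[of "n - p"] p False by simp
    qed auto
  qed
  then have "range a \<subseteq> a ` {..<N + p}" by auto
  then show ?thesis by (rule finite_subset) simp
qed

section \<open>Integral independence of the powers of a root of \<open>x^4 - x - 1\<close>\<close>

text \<open>
  The form below is the norm of \<open>a + b * \<beta> + c * \<beta>\<^sup>2 + d * \<beta> ^ 3\<close>. It is anisotropic modulo \<open>2\<close>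
  because \<open>x ^ 4 - x - 1\<close> is irreducible there.
\<close>

definition quartic_norm :: "'a::comm_ring_1 \<Rightarrow> 'a \<Rightarrow> 'a \<Rightarrow> 'a \<Rightarrow> 'a" where
  "quartic_norm a b c d = a^4 + 3*a^3*d - 3*a^2*b*c - 4*a^2*b*d - 2*a^2*c^2 + 3*a^2*d^2 + a*b^3
    + 4*a*b^2*c - 3*a*b*c*d - 5*a*b*d^2 + a*c^3 + a*c^2*d + 4*a*c*d^2 + a*d^3 - b^4 + 3*b^2*c*d
    + 2*b^2*d^2 - b*c^3 - 4*b*c^2*d - b*d^3 + c^4 + c*d^3 - d^4"

lemma even_quartic_norm:
  fixes a b c d :: int
  assumes "even (quartic_norm a b c d)"
  shows "even a \<and> even b \<and> even c \<and> even d"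
  using assms unfolding quartic_norm_def
  by (cases "even a"; cases "even b"; cases "even c"; cases "even d") simp_all

lemma quartic_norm_eq_0:
  fixes x a b c d :: "'a::comm_ring_1"
  assumes x: "x ^ 4 = x + 1" and 0: "a + b * x + c * x^2 + d * x^3 = 0"
  shows "quartic_norm a b c d = 0"
proof -
  \<comment> \<open>Multiplication by \<open>x\<close>, with \<open>x^4\<close> reduced to
    \<open>x + 1\<close>. Three applications turn one relation into four.\<close>
  have shift: "d' + (a' + d') * x + b' * x^2 + c' * x^3 = 0"
    if "a' + b' * x + c' * x^2 + d' * x^3 = 0" for a' b' c' d'
  proof -
    have "d' + (a' + d') * x + b' * x^2 + c' * x^3 =
        x * (a' + b' * x + c' * x^2 + d' * x^3) - d' * (x^4 - (x + 1))"
      by (simp add: algebra_simps eval_nat_numeral)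
    then show ?thesis unfolding that x by simp
  qed
  note 1 = shift[OF 0]
  note 2 = shift[OF 1]
  note 3 = shift[OF 2]
  \<comment> \<open>The norm is the determinant of multiplication by \<open>a + b * x + c * x\<^sup>2 + d * x ^ 3\<close>; the coefficients
    are the cofactors of its first column.\<close>
  have "quartic_norm a b c d =
      (a^3 + 3*a^2*d - 3*a*b*c - 2*a*b*d - a*c^2 + 3*a*d^2 + b^3 + b^2*c - 3*b*c*d - 2*b*d^2
        + c^3 + c^2*d + c*d^2 + d^3) * (a + b * x + c * x^2 + d * x^3)
    + (- (a^2*b) - a*b*d + a*c^2 + 2*a*c*d + b^2*d - b*c^2 - d^3)
        * (d + (a + d) * x + b * x^2 + c * x^3)
    + (- (a^2*c) + a*b^2 - a*c*d + a*d^2 - 2*b*c*d + c^3 + d^3)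
        * (c + (d + c) * x + (a + d) * x^2 + b * x^3)
    + (- (a^2*d) + 2*a*b*c - 2*a*d^2 - b^3 + 3*b*c*d + b*d^2 - c^3 - c^2*d - d^3)
        * (b + (c + b) * x + (d + c) * x^2 + (a + d) * x^3)"
    unfolding quartic_norm_def by (simp add: algebra_simps eval_nat_numeral)
  then show ?thesis unfolding 0 1 2 3 by simp
qed

text \<open>Infinite descent: the norm vanishes, so all coefficients are even, and halving them
  gives a smaller relation.\<close>

lemma quartic_root_independent:
  fixes x :: "'a::{idom,ring_char_0}" and a b c d :: int
  assumes x: "x ^ 4 = x + 1"
    and "of_int a + of_int b * x + of_int c * x^2 + of_int d * x^3 = 0"
  shows "a = 0 \<and> b = 0 \<and> c = 0 \<and> d = 0"
  using assms(2)
proof (induction "nat (\<bar>a\<bar> + \<bar>b\<bar> + \<bar>c\<bar> + \<bar>d\<bar>)" arbitrary: a b c d rule: less_induct)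
  case less
  have "(of_int (quartic_norm a b c d) :: 'a) = quartic_norm (of_int a) (of_int b) (of_int c) (of_int d)"
    unfolding quartic_norm_def by simp
  also have "\<dots> = 0" using x less.prems by (rule quartic_norm_eq_0)
  finally have "quartic_norm a b c d = 0" by simp
  then have "even (quartic_norm a b c d)" by simp
  then obtain a' b' c' d' where h: "a = 2 * a'" "b = 2 * b'" "c = 2 * c'" "d = 2 * d'"
    using even_quartic_norm by (meson dvdE)
  have "2 * (of_int a' + of_int b' * x + of_int c' * x^2 + of_int d' * x^3) = 0"
    using less.prems unfolding h by (simp add: algebra_simps)
  then have "of_int a' + of_int b' * x + of_int c' * x^2 + of_int d' * x^3 = 0"
    unfolding mult_eq_0_iff by simp
  \<comment> \<open>Halving decreases the measure strictly only if some coefficient is nonzero,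
    hence the guard.\<close>
  then have "\<bar>a\<bar> + \<bar>b\<bar> + \<bar>c\<bar> + \<bar>d\<bar> > 0 \<Longrightarrow> a' = 0 \<and> b' = 0 \<and> c' = 0 \<and> d' = 0"
    by (intro less.hyps) (auto simp: h abs_mult)
  then show ?case unfolding h by linarith
qed

section \<open>Location of the real roots and of a non-real conjugate\<close>

text \<open>The function \<open>t * (t^3 - 1)\<close> increases for \<open>t > 1\<close>, and its
  value at \<open>\<beta>\<close> is 1.\<close>

lemma quartic_root_bounds:
  fixes \<beta> :: real
  assumes "\<beta> > 1" "\<beta> ^ 4 = \<beta> + 1"
  shows "1.2207 < \<beta>" "\<beta> < 1.2208"
proof -
  have eq: "\<beta> * (\<beta> ^ 3 - 1) = 1" using assms(2) by algebra
  show "1.2207 < \<beta>"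
  proof (rule ccontr)
    assume "\<not> ?thesis"
    then have "\<beta> ^ 3 - 1 \<le> 1.2207 ^ 3 - 1" "\<beta> \<le> 1.2207"
      using assms(1) power_mono[of \<beta> "1.2207" 3] by auto
    then have "\<beta> * (\<beta> ^ 3 - 1) \<le> 1.2207 * (1.2207 ^ 3 - 1)"
      using assms(1) by (intro mult_mono) auto
    then show False unfolding eq by (simp add: power3_eq_cube)
  qed
  show "\<beta> < 1.2208"
  proof (rule ccontr)
    assume "\<not> ?thesis"
    then have "1.2208 ^ 3 - 1 \<le> \<beta> ^ 3 - 1" "1.2208 \<le> \<beta>"
      using power_mono[of "1.2208" \<beta> 3] by auto
    then have "1.2208 * (1.2208 ^ 3 - 1) \<le> \<beta> * (\<beta> ^ 3 - 1)"
      using assms(1) by (intro mult_mono) auto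
    then show False unfolding eq by (simp add: power3_eq_cube)
  qed
qed

text \<open>The last inequality says precisely that
  \<open>\<bar>\<gamma>\<bar>^7 * (\<bar>\<gamma>\<bar> * r - 1) > r\<close> at
  \<open>r = \<bar>\<gamma>^7 * (\<gamma> - 1)\<bar>\<close>, the threshold for growth after a digit
  1.\<close>

lemma quartic_conjugate:
  fixes \<beta> :: real
  assumes "\<beta> > 1" "\<beta> ^ 4 = \<beta> + 1"
  obtains \<gamma> :: complex where "\<gamma> ^ 4 = \<gamma> + 1" "cmod \<gamma> > 1" "cmod (\<gamma> - 1) * (cmod \<gamma> ^ 8 - 1) > 1"
proof -
  note \<beta> = quartic_root_bounds[OF assms]
  have "\<exists>x. -0.7245 \<le> x \<and> x \<le> -0.7244 \<and> x^4 - x - 1 = (0::real)"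
    by (rule IVT2) (auto simp: power4_eq_xxxx intro!: continuous_intros)
  then obtain \<alpha> :: real where \<alpha>: "-0.7245 \<le> \<alpha>" "\<alpha> \<le> -0.7244" and \<alpha>4: "\<alpha>^4 = \<alpha> + 1" by force
  define s where "s = \<alpha> + \<beta>"
  define q where "q = \<alpha>^2 + \<alpha> * \<beta> + \<beta>^2"
  have "(\<alpha> - \<beta>) * (\<alpha>^3 + \<alpha>^2 * \<beta> + \<alpha> * \<beta>^2 + \<beta>^3) = \<alpha> - \<beta>"
    using \<alpha>4 assms(2) by algebra
  then have h3: "\<alpha>^3 + \<alpha>^2 * \<beta> + \<alpha> * \<beta>^2 + \<beta>^3 = 1"
    using \<alpha> assms(1) by simp
  \<comment> \<open>\<open>c1\<close> and \<open>c0\<close> compare coefficients in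
    \<open>x^4 - x - 1 = (x^2 - s*x + s^2 - q) * (x^2 + s*x + q)\<close>. The first factor has the
    roots \<open>\<alpha>\<close> and \<open>\<beta>\<close>; \<open>\<gamma>\<close> is a root of
    the second.\<close>
  have c1: "s * (2 * q - s^2) = 1" using h3 unfolding s_def q_def by algebra
  have c0: "q * (q - s^2) = 1" using h3 \<alpha>4 unfolding s_def q_def by algebra
  have "(0.7244)\<^sup>2 \<le> (- \<alpha>)\<^sup>2" using \<alpha> by (intro power_mono) auto
  moreover have "1.2207\<^sup>2 \<le> \<beta>\<^sup>2" using \<beta> by (intro power_mono) auto
  moreover have "(- \<alpha>) * \<beta> \<le> 0.7245 * 1.2208" using \<alpha> \<beta> by (intro mult_mono) auto
  ultimately have q: "q \<ge> 1.13" unfolding q_def by (simp add: power2_eq_square)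
  have "s \<ge> 0.4962" "s \<le> 0.5" using \<alpha> \<beta> unfolding s_def by auto
  moreover from this have "s^2 \<le> 0.5^2" by (intro power_mono) auto
  ultimately have s: "s \<ge> 0.4962" "s^2 / 4 \<le> q" using q by (auto simp: power2_eq_square)
  define \<gamma> where "\<gamma> = Complex (- s / 2) (sqrt (q - s^2 / 4))"
  have "\<gamma>^2 + of_real s * \<gamma> + of_real q = 0"
    using s(2) by (simp add: complex_eq_iff \<gamma>_def power2_eq_square field_simps)
  then have "\<gamma>^4 - of_real (s * (2 * q - s^2)) * \<gamma> - of_real (q * (q - s^2)) = 0"
    unfolding of_real_mult of_real_diff of_real_power of_real_numeral by algebra
  then have g4: "\<gamma>^4 = \<gamma> + 1" unfolding c0 c1 by (simp add: algebra_simps)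
  have n2: "cmod \<gamma> ^ 2 = q"
    using s(2) unfolding cmod_power2 by (simp add: \<gamma>_def power2_eq_square field_simps)
  \<comment> \<open>This is the value of \<open>x^2 + s*x + q\<close> at 1, since its roots are
    \<open>\<gamma>\<close> and its complex conjugate.\<close>
  have "cmod (\<gamma> - 1) ^ 2 = q + s + 1"
    using s(2) n2 unfolding cmod_power2 by (simp add: \<gamma>_def power2_eq_square field_simps)
  then have "cmod (\<gamma> - 1) ^ 2 \<ge> 1.62 ^ 2" using q s by (simp add: power2_eq_square)
  then have l1: "cmod (\<gamma> - 1) \<ge> 1.62" by (rule power2_le_imp_le) simp
  have "q ^ 4 \<ge> 1.13 ^ 4" using q by (intro power_mono) auto
  moreover have "cmod \<gamma> ^ 8 = q ^ 4" unfolding n2[symmetric] by simp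
  ultimately have l8: "cmod \<gamma> ^ 8 - 1 \<ge> 0.63" by (simp add: power4_eq_xxxx)
  \<comment> \<open>The margin is small: \<open>1.62 * 0.63 = 1.0206\<close>.\<close>
  have "1.62 * 0.63 \<le> cmod (\<gamma> - 1) * (cmod \<gamma> ^ 8 - 1)" using l1 l8 by (intro mult_mono) auto
  then have "cmod (\<gamma> - 1) * (cmod \<gamma> ^ 8 - 1) > 1" by simp
  moreover have "cmod \<gamma> > 1"
    using q n2 by (intro power_less_imp_less_base[of 1 2 "cmod \<gamma>"]) simp_all
  ultimately show ?thesis using that g4 by blast
qed

section \<open>The conjugate orbit and its growth\<close>

text \<open>The digits are read off the real orbit, so this is not defined as the iteration of a map
  on the complex plane.\<close>

primrec conjugate_orbit :: "real \<Rightarrow> complex \<Rightarrow> nat \<Rightarrow> complex" where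
  "conjugate_orbit \<beta> \<gamma> 0 = 1"
| "conjugate_orbit \<beta> \<gamma> (Suc n) =
    \<gamma> * conjugate_orbit \<beta> \<gamma> n - of_int \<lfloor>\<beta> * (beta_map \<beta> ^^ n) 1\<rfloor>"

text \<open>Both recursions multiply by a root of the same quartic and subtract the same digit, so
  they act identically on integer coordinates.\<close>

lemma orbit_representation:
  assumes "\<beta> ^ 4 = \<beta> + 1" "\<gamma> ^ 4 = \<gamma> + 1"
  shows "\<exists>a b c d :: int.
      (beta_map \<beta> ^^ n) 1 = of_int a + of_int b * \<beta> + of_int c * \<beta>^2 + of_int d * \<beta>^3
    \<and> conjugate_orbit \<beta> \<gamma> n = of_int a + of_int b * \<gamma> + of_int c * \<gamma>^2 + of_int d * \<gamma>^3"
proof (induction n)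
  case 0
  show ?case by (intro exI[of _ 1] exI[of _ 0]) simp
next
  case (Suc n)
  then obtain a b c d :: int where
    x: "(beta_map \<beta> ^^ n) 1 = of_int a + of_int b * \<beta> + of_int c * \<beta>^2 + of_int d * \<beta>^3"
    and z: "conjugate_orbit \<beta> \<gamma> n = of_int a + of_int b * \<gamma> + of_int c * \<gamma>^2 + of_int d * \<gamma>^3"
    by blast
  define k where "k = \<lfloor>\<beta> * (beta_map \<beta> ^^ n) 1\<rfloor>"
  have "(beta_map \<beta> ^^ Suc n) 1 = \<beta> * (beta_map \<beta> ^^ n) 1 - of_int k"
    by (simp add: beta_map_def k_def)
  also have "\<dots> = of_int (d - k) + of_int (a + d) * \<beta> + of_int b * \<beta>^2 + of_int c * \<beta>^3"
    unfolding x of_int_add of_int_diff using assms(1) by algebra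
  finally have x': "(beta_map \<beta> ^^ Suc n) 1 = \<dots>" .
  have "conjugate_orbit \<beta> \<gamma> (Suc n) = \<gamma> * conjugate_orbit \<beta> \<gamma> n - of_int k"
    by (simp add: k_def)
  also have "\<dots> = of_int (d - k) + of_int (a + d) * \<gamma> + of_int b * \<gamma>^2 + of_int c * \<gamma>^3"
    unfolding z of_int_add of_int_diff using assms(2) by algebra
  finally show ?case using x' by blast
qed

text \<open>Integer coordinates with respect to the powers of \<open>\<beta>\<close> are unique, so
  each real term determines its conjugate. This transfers periodicity.\<close>

lemma conjugate_orbit_cong:
  assumes "\<beta> ^ 4 = \<beta> + 1" "\<gamma> ^ 4 = \<gamma> + 1"
    and eq: "(beta_map \<beta> ^^ m) 1 = (beta_map \<beta> ^^ n) 1"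
  shows "conjugate_orbit \<beta> \<gamma> m = conjugate_orbit \<beta> \<gamma> n"
proof -
  obtain a b c d :: int where m:
    "(beta_map \<beta> ^^ m) 1 = of_int a + of_int b * \<beta> + of_int c * \<beta>^2 + of_int d * \<beta>^3"
    "conjugate_orbit \<beta> \<gamma> m = of_int a + of_int b * \<gamma> + of_int c * \<gamma>^2 + of_int d * \<gamma>^3"
    using orbit_representation[OF assms(1,2)] by blast
  obtain a' b' c' d' :: int where n:
    "(beta_map \<beta> ^^ n) 1 = of_int a' + of_int b' * \<beta> + of_int c' * \<beta>^2 + of_int d' * \<beta>^3"
    "conjugate_orbit \<beta> \<gamma> n = of_int a' + of_int b' * \<gamma> + of_int c' * \<gamma>^2 + of_int d' * \<gamma>^3"
    using orbit_representation[OF assms(1,2)] by blast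
  have "of_int (a - a') + of_int (b - b') * \<beta> + of_int (c - c') * \<beta>^2 + of_int (d - d') * \<beta>^3 = 0"
    using eq unfolding m n by (simp add: algebra_simps)
  from quartic_root_independent[OF assms(1) this] show ?thesis unfolding m n by simp
qed

lemma beta_orbit_bounds:
  "0 \<le> (beta_map \<beta> ^^ n) 1" "(beta_map \<beta> ^^ n) 1 \<le> 1"
proof -
  have "0 \<le> (beta_map \<beta> ^^ n) 1 \<and> (beta_map \<beta> ^^ n) 1 \<le> 1"
    by (induction n) (auto simp: beta_map_def, linarith+)
  then show "0 \<le> (beta_map \<beta> ^^ n) 1" "(beta_map \<beta> ^^ n) 1 \<le> 1" by auto
qed

text \<open>As long as at most seven factors \<open>\<beta>\<close> are applied, a point not above
  \<open>\<beta> - 1\<close> stays below 1, so every digit met on the way is 0.\<close>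

lemma zero_digits:
  assumes "\<beta> > 1" "\<beta> ^ 7 * (\<beta> - 1) < 1" "(beta_map \<beta> ^^ m) 1 \<le> \<beta> - 1" "j \<le> 7"
  shows "(beta_map \<beta> ^^ (m + j)) 1 = \<beta> ^ j * (beta_map \<beta> ^^ m) 1
    \<and> conjugate_orbit \<beta> \<gamma> (m + j) = \<gamma> ^ j * conjugate_orbit \<beta> \<gamma> m"
  using assms(4)
proof (induction j)
  case (Suc j)
  let ?x = "(beta_map \<beta> ^^ m) 1"
  have "\<beta> * (beta_map \<beta> ^^ (m + j)) 1 = \<beta> ^ Suc j * ?x" using Suc by simp
  moreover have "\<lfloor>\<beta> ^ Suc j * ?x\<rfloor> = 0"
  proof -
    have "\<beta> ^ Suc j * ?x \<le> \<beta> ^ 7 * (\<beta> - 1)"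
      using assms Suc.prems beta_orbit_bounds
      by (intro mult_mono power_increasing) auto
    moreover have "0 \<le> \<beta> ^ Suc j * ?x"
      using assms beta_orbit_bounds by (intro mult_nonneg_nonneg) auto
    ultimately show ?thesis using assms by (simp add: floor_eq_iff)
  qed
  ultimately have fl: "\<lfloor>\<beta> * (beta_map \<beta> ^^ (m + j)) 1\<rfloor> = 0" by (simp only:)
  have "(beta_map \<beta> ^^ (m + Suc j)) 1 = \<beta> * (beta_map \<beta> ^^ (m + j)) 1"
    using fl by (simp add: beta_map_def)
  moreover have "conjugate_orbit \<beta> \<gamma> (m + Suc j) = \<gamma> * conjugate_orbit \<beta> \<gamma> (m + j)"
    using fl by simp
  ultimately show ?case using Suc by simp
qed simp

lemma conjugate_orbit_grows:
  assumes \<beta>: "1 < \<beta>" "\<beta> < 2" "\<beta> ^ 7 * (\<beta> - 1) < 1"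
    and \<gamma>: "cmod \<gamma> > 1" "cmod (\<gamma> - 1) * (cmod \<gamma> ^ 8 - 1) > 1"
    and large: "cmod (\<gamma> ^ 7 * (\<gamma> - 1)) \<le> cmod (conjugate_orbit \<beta> \<gamma> n)"
  obtains m where "cmod (conjugate_orbit \<beta> \<gamma> n) < cmod (conjugate_orbit \<beta> \<gamma> m)"
proof -
  let ?x = "(beta_map \<beta> ^^ n) 1" and ?z = "conjugate_orbit \<beta> \<gamma> n"
  have "\<gamma> \<noteq> 0" "\<gamma> \<noteq> 1" using \<gamma> by auto
  then have "0 < cmod (\<gamma> ^ 7 * (\<gamma> - 1))" by simp
  then have z0: "0 < cmod ?z" using large by linarith
  have "0 \<le> \<beta> * ?x" using \<beta> beta_orbit_bounds by (intro mult_nonneg_nonneg) auto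
  moreover have le: "\<beta> * ?x \<le> \<beta>" using \<beta> beta_orbit_bounds(2) by (simp add: mult_le_cancel_left1)
  ultimately have "\<lfloor>\<beta> * ?x\<rfloor> = 0 \<or> \<lfloor>\<beta> * ?x\<rfloor> = 1" using \<beta> by linarith
  then show ?thesis
  proof
    assume "\<lfloor>\<beta> * ?x\<rfloor> = 0"
    then have "cmod (conjugate_orbit \<beta> \<gamma> (Suc n)) = cmod \<gamma> * cmod ?z"
      by (simp add: norm_mult)
    then show ?thesis using that[of "Suc n"] \<gamma>(1) z0 by simp
  next
    assume fl: "\<lfloor>\<beta> * ?x\<rfloor> = 1"
    then have "(beta_map \<beta> ^^ Suc n) 1 \<le> \<beta> - 1" using le by (simp add: beta_map_def)
    from zero_digits[OF \<beta>(1,3) this, of 7 \<gamma>]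
    have "conjugate_orbit \<beta> \<gamma> (Suc n + 7) = \<gamma> ^ 7 * (\<gamma> * ?z - 1)" using fl by simp
    also have "cmod \<dots> = cmod \<gamma> ^ 7 * cmod (\<gamma> * ?z - 1)" by (simp add: norm_mult norm_power)
    finally have step: "cmod (conjugate_orbit \<beta> \<gamma> (Suc n + 7)) = \<dots>" .
    \<comment> \<open>The hypothesis on \<open>\<gamma>\<close>, scaled by
      \<open>\<bar>\<gamma>\<bar>^7\<close> to bring in the lower bound on the modulus of the
      term.\<close>
    have "cmod \<gamma> ^ 7 * 1 < cmod \<gamma> ^ 7 * (cmod (\<gamma> - 1) * (cmod \<gamma> ^ 8 - 1))"
      using \<gamma> by (intro mult_strict_left_mono) auto
    also have "\<dots> = cmod (\<gamma> ^ 7 * (\<gamma> - 1)) * (cmod \<gamma> ^ 8 - 1)"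
      by (simp add: norm_mult norm_power)
    also have "\<dots> \<le> cmod ?z * (cmod \<gamma> ^ 8 - 1)"
      using large \<gamma>(1) by (intro mult_right_mono) auto
    finally have "cmod ?z < cmod \<gamma> ^ 7 * (cmod \<gamma> * cmod ?z - 1)"
      by (simp add: algebra_simps eval_nat_numeral)
    also have "\<dots> \<le> cmod \<gamma> ^ 7 * cmod (\<gamma> * ?z - 1)"
      using norm_triangle_ineq2[of "\<gamma> * ?z" 1]
      by (intro mult_left_mono) (auto simp: norm_mult)
    finally show ?thesis using that step by metis
  qed
qed

lemma beta_orbit_aperiodic:
  fixes \<beta> :: real
  assumes "\<beta> > 1" "\<beta> ^ 4 = \<beta> + 1"
  shows "\<not> eventually_periodic (\<lambda>n. (beta_map \<beta> ^^ n) 1)"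
proof
  assume per: "eventually_periodic (\<lambda>n. (beta_map \<beta> ^^ n) 1)"
  note \<beta> = quartic_root_bounds[OF assms]
  obtain \<gamma> where \<gamma>: "\<gamma> ^ 4 = \<gamma> + 1" "cmod \<gamma> > 1" "cmod (\<gamma> - 1) * (cmod \<gamma> ^ 8 - 1) > 1"
    using quartic_conjugate[OF assms] by blast
  have "\<beta> ^ 7 * (\<beta> - 1) \<le> 1.2208 ^ 7 * (1.2208 - 1)"
    using \<beta> by (intro mult_mono power_mono) auto
  also have "\<dots> < 1" by (simp add: eval_nat_numeral)
  finally have \<beta>7: "\<beta> ^ 7 * (\<beta> - 1) < 1" .
  have \<beta>2: "\<beta> < 2" using \<beta> by simp
  have fl: "\<lfloor>\<beta>\<rfloor> = 1" using \<beta> by (simp add: floor_eq_iff)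
  \<comment> \<open>The first digit is 1, so seven zeros follow from index 1, where the conjugate
    term is \<open>\<gamma> - 1\<close>. Index 8 then shows that the maximal modulus reaches the
    growth threshold.\<close>
  have "(beta_map \<beta> ^^ 1) 1 \<le> \<beta> - 1" using fl by (simp add: beta_map_def)
  from zero_digits[OF assms(1) \<beta>7 this, of 7 \<gamma>]
  have z8: "conjugate_orbit \<beta> \<gamma> 8 = \<gamma> ^ 7 * (\<gamma> - 1)" using fl by simp
  have "eventually_periodic (conjugate_orbit \<beta> \<gamma>)"
    using per conjugate_orbit_cong[OF assms(2) \<gamma>(1)] unfolding eventually_periodic_def by meson
  then have fin: "finite (range (\<lambda>n. cmod (conjugate_orbit \<beta> \<gamma> n)))"
    using finite_imageI[OF eventually_periodic_finite_range, of _ cmod] unfolding image_image by blast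
  obtain n where n: "Max (range (\<lambda>n. cmod (conjugate_orbit \<beta> \<gamma> n))) = cmod (conjugate_orbit \<beta> \<gamma> n)"
    using Max_in[OF fin] by auto
  have max: "cmod (conjugate_orbit \<beta> \<gamma> m) \<le> cmod (conjugate_orbit \<beta> \<gamma> n)" for m
    unfolding n[symmetric] using fin by (intro Max_ge) auto
  have "cmod (\<gamma> ^ 7 * (\<gamma> - 1)) \<le> cmod (conjugate_orbit \<beta> \<gamma> n)" using max[of 8] by (simp add: z8)
  from conjugate_orbit_grows[OF assms(1) \<beta>2 \<beta>7 \<gamma>(2,3) this] obtain m where
    "cmod (conjugate_orbit \<beta> \<gamma> n) < cmod (conjugate_orbit \<beta> \<gamma> m)" .
  then show False using max[of m] by simp
qed

section \<open>The orbit of 1 under the negative transformation\<close>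

lemma neg_beta_map_eq:
  assumes "of_int k \<le> \<beta> * x" "\<beta> * x < of_int k + 1" "y = of_int k + 1 - \<beta> * x"
  shows "neg_beta_map \<beta> x = y"
proof -
  have "\<lfloor>\<beta> * x\<rfloor> = k" using assms(1,2) by (simp add: floor_eq_iff)
  then show ?thesis unfolding neg_beta_map_def assms(3) by simp
qed

lemma neg_beta_orbit:
  fixes \<beta> :: real
  assumes "\<beta> > 1" "\<beta> ^ 4 = \<beta> + 1"
  shows "(neg_beta_map \<beta> ^^ 10) 1 = (neg_beta_map \<beta> ^^ 5) 1"
proof -
  note \<beta> = quartic_root_bounds[OF assms]
  have "1.2207 ^ 2 \<le> \<beta> ^ 2" "\<beta> ^ 2 \<le> 1.2208 ^ 2" "1.2207 ^ 3 \<le> \<beta> ^ 3" "\<beta> ^ 3 \<le> 1.2208 ^ 3"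
    using \<beta> by (auto intro!: power_mono)
  then have bounds: "1.49 \<le> \<beta>^2" "\<beta>^2 \<le> 1.4904" "1.8189 \<le> \<beta>^3" "\<beta>^3 \<le> 1.8195"
    by (simp_all add: power2_eq_square power3_eq_cube)
  \<comment> \<open>One iteration in coordinates, with \<open>\<beta>^4\<close> reduced to
    \<open>\<beta> + 1\<close>. The integer \<open>k\<close> is the right floor exactly because the
    result lies in \<open>(0,1]\<close>.\<close>
  have step: "neg_beta_map \<beta> (a + b * \<beta> + c * \<beta>^2 + d * \<beta>^3) = a' + b' * \<beta> + c' * \<beta>^2 + d' * \<beta>^3"
    if "a' = of_int k + 1 - d" "b' = - (a + d)" "c' = - b" "d' = - c"
      "0 < a' + b' * \<beta> + c' * \<beta>^2 + d' * \<beta>^3" "a' + b' * \<beta> + c' * \<beta>^2 + d' * \<beta>^3 \<le> 1"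
    for a b c d a' b' c' d' :: real and k :: int
  proof -
    have "a' + b' * \<beta> + c' * \<beta>^2 + d' * \<beta>^3
        = of_int k + 1 - \<beta> * (a + b * \<beta> + c * \<beta>^2 + d * \<beta>^3)"
      unfolding that(1-4) using assms(2) by algebra
    then show ?thesis using that(5,6) by (intro neg_beta_map_eq[of k]) auto
  qed
  let ?T = "neg_beta_map \<beta>"
  \<comment> \<open>The arguments of \<open>step\<close> come in the order \<open>a'\<close>,
    \<open>k\<close>, \<open>d\<close>, \<open>b'\<close>, \<open>a\<close>, \<open>c'\<close>,
    \<open>b\<close>, \<open>d'\<close>, \<open>c\<close>; the second is the floor.\<close>
  have 1: "?T 1 = 2 - \<beta>"
    using step[of 2 1 0 "-1" 1 0 0 0 0] \<beta> by simp
  have 2: "?T (2 - \<beta>) = 1 - 2 * \<beta> + \<beta>^2"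
    using step[of 1 0 0 "-2" 2 1 "-1" 0 0] \<beta> bounds by simp
  have 3: "?T (1 - 2 * \<beta> + \<beta>^2) = 1 - \<beta> + 2 * \<beta>^2 - \<beta>^3"
    using step[of 1 0 0 "-1" 1 2 "-2" "-1" 1] \<beta> bounds by simp
  have 4: "?T (1 - \<beta> + 2 * \<beta>^2 - \<beta>^3) = 3 + \<beta>^2 - 2 * \<beta>^3"
    using step[of 3 1 "-1" 0 1 1 "-1" "-2" 2] \<beta> bounds by simp
  have 5: "?T (3 + \<beta>^2 - 2 * \<beta>^3) = 4 - \<beta> - \<beta>^3"
    using step[of 4 1 "-2" "-1" 3 0 0 "-1" 1] \<beta> bounds by simp
  have 6: "?T (4 - \<beta> - \<beta>^3) = 3 - 3 * \<beta> + \<beta>^2"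
    using step[of 3 1 "-1" "-3" 4 1 "-1" 0 0] \<beta> bounds by simp
  have 7: "?T (3 - 3 * \<beta> + \<beta>^2) = 2 - 3 * \<beta> + 3 * \<beta>^2 - \<beta>^3"
    using step[of 2 1 0 "-3" 3 3 "-3" "-1" 1] \<beta> bounds by simp
  have 8: "?T (2 - 3 * \<beta> + 3 * \<beta>^2 - \<beta>^3) = 3 - \<beta> + 3 * \<beta>^2 - 3 * \<beta>^3"
    using step[of 3 1 "-1" "-1" 2 3 "-3" "-3" 3] \<beta> bounds by simp
  have 9: "?T (3 - \<beta> + 3 * \<beta>^2 - 3 * \<beta>^3) = 4 + \<beta>^2 - 3 * \<beta>^3"
    using step[of 4 0 "-3" 0 3 1 "-1" "-3" 3] \<beta> bounds by simp
  \<comment> \<open>The value is that of the fifth iterate, which closes the cycle.\<close>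
  have 10: "?T (4 + \<beta>^2 - 3 * \<beta>^3) = 4 - \<beta> - \<beta>^3"
    using step[of 4 0 "-3" "-1" 4 0 0 "-1" 1] \<beta> bounds by simp
  have iter: "(?T ^^ 5) x = ?T (?T (?T (?T (?T x))))" for x
    by (simp add: eval_nat_numeral)
  have "(?T ^^ (5 + 5)) 1 = (?T ^^ 5) 1"
    unfolding funpow_add o_apply iter by (simp only: 1 2 3 4 5 6 7 8 9 10)
  then show ?thesis by simp
qed

theorem proposition6p1:
  fixes \<beta> :: real
  assumes "\<beta> > 1"
    and "\<beta> ^ 4 = \<beta> + 1"
  shows "(neg_beta_map \<beta> ^^ 10) 1 = (neg_beta_map \<beta> ^^ 5) 1
    \<and> \<not> eventually_periodic (\<lambda>n. (beta_map \<beta> ^^ n) 1)"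
  using neg_beta_orbit[OF assms] beta_orbit_aperiodic[OF assms] by blast

end
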